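(* Let $\delta,a,K\in\mathbb{N}$ satisfy $2\le a\le K-2$, let $f$ be a bistable reaction function with viability constant $a$ and capacity $K$, and let $F$ be the update rule of the bistable reaction-diffusion cellular automaton determined by $\delta$ and $f$. There exists a left traveling wave with $c=-1$, i.e. a wave profile $w$ with $F(w)_n=w_{n+1}$ for all $n\in\mathbb{Z}$, if and only if $a<\frac{K}{2}$ and there exists $p\in\left(a,\frac{K}{2}\right]_{\mathbb{Z}}$ satisfying $$\delta\ge p\qquad\text{and}\qquad f(p)\ge 2p.$$
   Context: $\mathbb{N}=\{1,2,\dots\}$, $\mathbb{N}_0=\mathbb{N}\cup\{0\}$; a subscript $\mathbb{Z}$ on an interval denotes its intersection with $\mathbb{Z}$, e.g. $(0,a)_{\mathbb{Z}}=(0,a)\cap\mathbb{Z}$. For $\delta\in\mathbb{N}$ define $h_\delta(m,n)\in\mathbb{Z}$ for $m,n\in\mathbb{N}_0$ by: $h_\delta(m,n)=\delta$ if $m-n\ge 2\delta$; $h_\delta(m,n)=-\delta$ if $m-n\le -2\delta$; for $j=1,\dots,\delta-1$, $h_\delta(m,n)=j$ if $m-n\in\{2j,2j+1\}$ and $h_\delta(m,n)=-j$ if $n-m\in\{2j,2j+1\}$; and $h_\delta(m,n)=0$ otherwise. For integers $a,K$ with $2\le a\le K-2$, a bistable reaction function with viability constant $a$ and capacity $K$ is a nondecreasing $f:\mathbb{N}_0\to\mathbb{N}_0$ with $f(0)=0$, $f(a)=a$, $f(K)=K$, $f(u)\in[0,u)_{\mathbb{Z}}$ for $u\in(0,a)_{\mathbb{Z}}$,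 $f(u)\in(u,K]_{\mathbb{Z}}$ for $u\in(a,K)_{\mathbb{Z}}$, and $f(u)\in[K,u)_{\mathbb{Z}}$ for $u\in(K,\infty)_{\mathbb{Z}}$. The bistable reaction-diffusion cellular automaton determined by $\delta$ and $f$ is $u(t+1)=F(u(t))$, $t\in\mathbb{N}_0$, where for $u\in\mathbb{N}_0^{\mathbb{Z}}$, $n\in\mathbb{Z}$, $$F(u)_n=f(u_n)+h_\delta(f(u_{n-1}),f(u_n))+h_\delta(f(u_{n+1}),f(u_n)).$$ A wave profile is a sequence $w=(w_n)_{n\in\mathbb{Z}}$ of nonnegative integers for which there is $N\in\mathbb{N}$ with $w_n=0$ for $n\le 0$, $w_n=K$ for $n\ge N$, and $0=w_0<w_1\le w_2\le\dots\le w_{N-1}<w_N=K$. *)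

theory Defs
  imports Complex_Main
begin

definition flux :: "nat \<Rightarrow> nat \<Rightarrow> nat \<Rightarrow> int" where
  "flux \<delta> m n =
    (let d = int m - int n;
         P = (\<lambda>x j. j \<in> {1..int \<delta> - 1} \<and> x \<in> {2 * j, 2 * j + 1})
     in if d \<ge> 2 * int \<delta> then int \<delta>
        else if d \<le> - 2 * int \<delta> then - int \<delta>
        else if \<exists>j. P d j then (THE j. P d j)
        else if \<exists>j. P (- d) j then - (THE j. P (- d) j)
        else 0)"

(* The index j in the definition is unique, so the descriptions are well defined. *)
lemma flux_eq:
  "flux \<delta> m n =
    (if m \<ge> n then min (int \<delta>) ((int m - int n) div 2)
     else - min (int \<delta>) ((int n - int m) div 2))"
proof -
  define d where "d = int m - int n"
  define P where "P = (\<lambda>x j. j \<in> {1..int \<delta> - 1} \<and> x \<in> {2 * j, 2 * j + 1})"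
  have P_iff: "P x j \<longleftrightarrow> 2 \<le> x \<and> x < 2 * int \<delta> \<and> j = x div 2" for x j
    unfolding P_def by auto
  have ex: "(\<exists>j. P x j) \<longleftrightarrow> 2 \<le> x \<and> x < 2 * int \<delta>" for x
    by (auto simp: P_iff)
  have the: "(THE j. P x j) = x div 2" if "2 \<le> x" "x < 2 * int \<delta>" for x
    using that by (simp add: P_iff)
  have unf: "flux \<delta> m n =
    (if d \<ge> 2 * int \<delta> then int \<delta> else if d \<le> - 2 * int \<delta> then - int \<delta>
     else if \<exists>j. P d j then (THE j. P d j)
     else if \<exists>j. P (- d) j then - (THE j. P (- d) j) else 0)"
    unfolding flux_def Let_def d_def P_def by (rule refl)
  have mn: "m \<ge> n \<longleftrightarrow> d \<ge> 0" "int m - int n = d" "int n - int m = - d"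
    by (auto simp: d_def)
  have "flux \<delta> m n = (if d \<ge> 0 then min (int \<delta>) (d div 2)
     else - min (int \<delta>) ((- d) div 2))"
    unfolding unf ex by (auto simp: the min_def)
  then show ?thesis
    by (simp only: mn)
qed

definition bistable_reaction :: "nat \<Rightarrow> nat \<Rightarrow> (nat \<Rightarrow> nat) \<Rightarrow> bool" where
  "bistable_reaction a K f \<longleftrightarrow>
     2 \<le> a \<and> a + 2 \<le> K \<and>
     mono f \<and> f 0 = 0 \<and> f a = a \<and> f K = K \<and>
     (\<forall>u\<in>{0<..<a}. f u \<in> {0..<u}) \<and>
     (\<forall>u\<in>{a<..<K}. f u \<in> {u<..K}) \<and>
     (\<forall>u\<in>{K<..}. f u \<in> {K..<u})"

definition ca_update :: "nat \<Rightarrow> (nat \<Rightarrow> nat) \<Rightarrow> (int \<Rightarrow> nat) \<Rightarrow> int \<Rightarrow> nat" where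
  "ca_update \<delta> f u n =
     nat (int (f (u n)) + flux \<delta> (f (u (n - 1))) (f (u n))
                        + flux \<delta> (f (u (n + 1))) (f (u n)))"

(* No truncation occurs in nat: the update maps nonnegative states to nonnegative states. *)
lemma int_ca_update:
  "int (ca_update \<delta> f u n) =
     int (f (u n)) + flux \<delta> (f (u (n - 1))) (f (u n)) + flux \<delta> (f (u (n + 1))) (f (u n))"
proof -
  have "2 * flux \<delta> m k \<ge> - int k" for m k
  proof (cases "k \<le> m")
    case True
    then have "flux \<delta> m k \<ge> 0" by (simp add: flux_eq)
    then show ?thesis by linarith
  next
    case False
    then have "flux \<delta> m k \<ge> - ((int k - int m) div 2)" by (simp add: flux_eq)
    moreover have "2 * ((int k - int m) div 2) \<le> int k - int m" by linarith
    ultimately show ?thesis by linarith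
  qed
  from this[of "f (u n)" "f (u (n - 1))"] this[of "f (u n)" "f (u (n + 1))"]
  show ?thesis
    unfolding ca_update_def by simp
qed

definition wave_profile :: "nat \<Rightarrow> (int \<Rightarrow> nat) \<Rightarrow> bool" where
  "wave_profile K w \<longleftrightarrow>
     (\<exists>N::int. 1 \<le> N \<and>
        (\<forall>n\<le>0. w n = 0) \<and> (\<forall>n\<ge>N. w n = K) \<and>
        0 < w 1 \<and> (\<forall>n. 1 \<le> n \<and> n < N - 1 \<longrightarrow> w n \<le> w (n + 1)) \<and>
        w (N - 1) < K)"

end

theory Submission
  imports Defs
begin

text \<open>
  Write \<open>g n = f (w n)\<close> and let \<open>J n\<close> be the flux from site \<open>n + 1\<close> into site \<open>n\<close>. Since the flux
  is antisymmetric, a left travelling wave of speed \<open>-1\<close> is a solution of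
  \<open>w (n + 1) = g n - J (n - 1) + J n\<close>.

  For necessity only site \<open>0\<close> matters: there the equation reads \<open>w 1 = min \<delta> (g 1 div 2)\<close>, so
  \<open>p = w 1\<close> satisfies \<open>p \<le> \<delta>\<close> and \<open>f p \<ge> 2 * p > p\<close>. Only states strictly between \<open>a\<close> and
  \<open>K\<close> can grow under \<open>f\<close>, and their images are at most \<open>K\<close>, whence \<open>a < p \<le> K / 2\<close>.

  For sufficiency the wave is built from left to right. As \<open>J n\<close> depends on \<open>w (n + 1)\<close>, each
  step asks for a fixed point of a nondecreasing function of \<open>w (n + 1)\<close>. The first one is sought
  in \<open>{p..K}\<close>, where the two conditions on \<open>p\<close> say exactly that the lower end is mapped upwards;
  every later one in \<open>{w n..K}\<close>. That the lower end \<open>w n\<close> is mapped upwards means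
  \<open>w n + J (n - 1) \<le> g n\<close>, an invariant which reproduces itself because each flux moves at most
  half of the difference that drives it (\<open>front_extension\<close>). The profile so obtained is nondecreasing
  and bounded, hence eventually constant; on a constant stretch the fluxes vanish, so its height is
  a fixed point of \<open>f\<close> above \<open>a\<close>, which can only be \<open>K\<close>.
\<close>

section \<open>The flux\<close>

lemma flux_antisym: "flux \<delta> m n = - flux \<delta> n m"
  by (auto simp: flux_eq)

lemma flux_self [simp]: "flux \<delta> n n = 0"
  by (simp add: flux_eq)

lemma flux_nonneg: "n \<le> m \<Longrightarrow> 0 \<le> flux \<delta> m n"
  by (simp add: flux_eq)

lemma flux_le_bound: "flux \<delta> m n \<le> int \<delta>"
  by (auto simp: flux_eq)

lemma two_flux_le_diff: "n \<le> m \<Longrightarrow> 2 * flux \<delta> m n \<le> int m - int n"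
  by (auto simp: flux_eq min_def)

lemma flux_mono: "n \<le> m \<Longrightarrow> m \<le> m' \<Longrightarrow> flux \<delta> m n \<le> flux \<delta> m' n"
  by (auto simp: flux_eq min_def)

lemma flux_from_zero: "flux \<delta> m 0 = int (min \<delta> (m div 2))"
  by (auto simp: flux_eq min_def)

section \<open>Fixed points\<close>

lemma bistable_reaction_growing:
  assumes bist: "bistable_reaction a K f" and grow: "u < f u"
  shows "a < u \<and> u < K \<and> f u \<le> K"
proof -
  have fixed: "f 0 = 0" "f a = a" "f K = K"
    and below: "0 < u \<Longrightarrow> u < a \<Longrightarrow> f u < u"
    and between: "a < u \<Longrightarrow> u < K \<Longrightarrow> f u \<le> K"
    and above: "K < u \<Longrightarrow> f u < u"
    using bist by (simp_all add: bistable_reaction_def)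
  have "u \<noteq> 0" "u \<noteq> a" "u \<noteq> K"
    using fixed grow by (metis less_irrefl)+
  with below between above grow show ?thesis
    by linarith
qed

lemma bistable_reaction_fixed_above:
  assumes bist: "bistable_reaction a K f" and "a < u" and "u \<le> K" and "f u = u"
  shows "u = K"
proof -
  have "a < u \<Longrightarrow> u < K \<Longrightarrow> u < f u"
    using bist by (simp add: bistable_reaction_def)
  then show ?thesis
    using assms by linarith
qed

text \<open>A monotone integer function cannot jump across the diagonal downwards, so the first point
  that is not mapped strictly upwards is fixed.\<close>

lemma nat_interval_fixed_point:
  fixes G :: "nat \<Rightarrow> int"
  assumes "l \<le> u" and "int l \<le> G l" and "G u \<le> int u"
    and mono: "\<And>x y. l \<le> x \<Longrightarrow> x \<le> y \<Longrightarrow> y \<le> u \<Longrightarrow> G x \<le> G y"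
  obtains x where "l \<le> x" "x \<le> u" "G x = int x"
proof -
  define x where "x = (LEAST x. l \<le> x \<and> G x \<le> int x)"
  have x: "l \<le> x \<and> G x \<le> int x"
    unfolding x_def by (rule LeastI[of _ u]) (use assms in auto)
  have "x \<le> u"
    unfolding x_def by (rule Least_le) (use assms in auto)
  have "int x \<le> G x"
  proof (cases "x = l")
    case False
    then have "l \<le> x - 1" "x - 1 < x"
      using x by auto
    then have "int (x - 1) < G (x - 1)"
      unfolding x_def using not_less_Least by fastforce
    moreover have "G (x - 1) \<le> G x"
      using mono \<open>l \<le> x - 1\<close> \<open>x \<le> u\<close> by simp
    ultimately show ?thesis by linarith
  qed (use assms in simp)
  then show thesis
    using that x \<open>x \<le> u\<close> by force
qed

section \<open>Construction of the wave\<close>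

text \<open>The last conjunct leaves room for the next site: after passing its flux on to the left, the
  site with value \<open>y\<close> retains at least \<open>y\<close>.\<close>

definition wave_front :: "nat \<Rightarrow> nat \<Rightarrow> nat \<Rightarrow> (nat \<Rightarrow> nat) \<Rightarrow> nat \<times> nat \<Rightarrow> bool" where
  "wave_front \<delta> a K f = (\<lambda>(x, y). x \<le> y \<and> a < y \<and> y \<le> K \<and>
     int y + flux \<delta> (f y) (f x) \<le> int (f y))"

lemma front_start:
  assumes bist: "bistable_reaction a K f"
    and "a < p" and "p \<le> K" and "p \<le> \<delta>" and "2 * p \<le> f p"
  obtains z where "wave_front \<delta> a K f (0, z)" and "int z = flux \<delta> (f z) (f 0)"
proof -
  have f: "mono f" "f 0 = 0" "f K = K"
    using bist by (auto simp: bistable_reaction_def)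
  obtain z where z: "p \<le> z" "z \<le> K" "flux \<delta> (f z) 0 = int z"
  proof (rule nat_interval_fixed_point[of p K "\<lambda>z. flux \<delta> (f z) 0"])
    show "int p \<le> flux \<delta> (f p) 0" "flux \<delta> (f K) 0 \<le> int K"
      using assms by (auto simp: flux_from_zero f)
    show "flux \<delta> (f x) 0 \<le> flux \<delta> (f y) 0" if "x \<le> y" for x y
      using that f by (intro flux_mono) (auto dest: monoD)
  qed (use assms in auto)
  have "wave_front \<delta> a K f (0, z)"
    using z assms f two_flux_le_diff[of 0 "f z" \<delta>] by (simp add: wave_front_def)
  with z f show thesis
    by (intro that) auto
qed

text \<open>Half of the difference \<open>f z - f y\<close> suffices to pay the flux into the site of \<open>y\<close>. What is
  left over covers the same amount once more, which is the room required by the new front.\<close>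

lemma front_extension:
  assumes bist: "bistable_reaction a K f" and front: "wave_front \<delta> a K f (x, y)"
  obtains z where "wave_front \<delta> a K f (y, z)"
    and "int z = int (f y) - flux \<delta> (f y) (f x) + flux \<delta> (f z) (f y)"
proof -
  have mono: "f u \<le> f v" if "u \<le> v" for u v
    using bist that by (auto simp: bistable_reaction_def dest: monoD)
  have fK: "f K = K"
    using bist by (simp add: bistable_reaction_def)
  have xy: "x \<le> y" "a < y" "y \<le> K" "int y + flux \<delta> (f y) (f x) \<le> int (f y)"
    using front by (auto simp: wave_front_def)
  have J: "0 \<le> flux \<delta> (f y) (f x)"
    using xy mono by (intro flux_nonneg)
  have half: "0 \<le> flux \<delta> (f z) (f y)" "2 * flux \<delta> (f z) (f y) \<le> int (f z) - int (f y)"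
    if "y \<le> z" for z
    using mono[OF that] by (simp_all add: flux_nonneg two_flux_le_diff)
  let ?G = "\<lambda>z. int (f y) - flux \<delta> (f y) (f x) + flux \<delta> (f z) (f y)"
  obtain z where z: "y \<le> z" "z \<le> K" "?G z = int z"
  proof (rule nat_interval_fixed_point[of y K ?G])
    show "?G K \<le> int K"
      using half[of K] J xy fK by linarith
    show "?G u \<le> ?G v" if "y \<le> u" "u \<le> v" for u v
      using flux_mono[of "f y" "f u" "f v" \<delta>] mono that by simp
  qed (use xy in auto)
  then have "wave_front \<delta> a K f (y, z)"
    using half[of z] J xy by (simp add: wave_front_def)
  with z show thesis
    by (intro that) auto
qed

lemma monotone_front_exists:
  assumes bist: "bistable_reaction a K f"
    and "a < p" and "p \<le> K" and "p \<le> \<delta>" and "2 * p \<le> f p"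
  obtains V :: "nat \<Rightarrow> nat" where
    "V 0 = 0" "mono V" "\<And>n. V n \<le> K" "\<And>n. a < V (Suc n)"
    "int (V 1) = flux \<delta> (f (V 1)) (f 0)"
    "\<And>n. int (V (Suc (Suc n))) = int (f (V (Suc n)))
       - flux \<delta> (f (V (Suc n))) (f (V n)) + flux \<delta> (f (V (Suc (Suc n)))) (f (V (Suc n)))"
proof -
  let ?P = "\<lambda>n s. wave_front \<delta> a K f s \<and>
    (n = (0::nat) \<longrightarrow> fst s = 0 \<and> int (snd s) = flux \<delta> (f (snd s)) (f 0))"
  let ?Q = "\<lambda>n::nat. \<lambda>s t. fst t = snd s \<and> int (snd t) = int (f (snd s))
    - flux \<delta> (f (snd s)) (f (fst s)) + flux \<delta> (f (snd t)) (f (snd s))"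
  have "\<exists>s. \<forall>n. ?P n (s n) \<and> ?Q n (s n) (s (Suc n))"
  proof (rule dependent_nat_choice)
    show "\<exists>s. ?P 0 s"
      using front_start[OF assms] by (metis fst_conv snd_conv)
    show "\<exists>t. ?P (Suc n) t \<and> ?Q n s t" if "?P n s" for s n
      using that front_extension[OF bist, of \<delta> "fst s" "snd s"]
      by (metis fst_conv snd_conv nat.distinct(2) prod.collapse)
  qed
  then obtain s where P: "\<And>n. ?P n (s n)" and Q: "\<And>n. ?Q n (s n) (s (Suc n))"
    by blast
  define V where "V n = fst (s n)" for n
  have snd_V: "snd (s n) = V (Suc n)" for n
    using Q[of n] by (simp add: V_def)
  have front: "wave_front \<delta> a K f (V n, V (Suc n))" for n
    using P[of n] by (metis V_def snd_V prod.collapse)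
  show thesis
  proof
    show "V 0 = 0" "int (V 1) = flux \<delta> (f (V 1)) (f 0)"
      using P[of 0] by (simp_all add: V_def[of 0] snd_V)
    show "mono V"
      using front by (auto simp: wave_front_def intro: incseq_SucI)
    show "V n \<le> K" "a < V (Suc n)" for n
      using front[of n] by (auto simp: wave_front_def)
    show "int (V (Suc (Suc n))) = int (f (V (Suc n)))
       - flux \<delta> (f (V (Suc n))) (f (V n)) + flux \<delta> (f (V (Suc (Suc n)))) (f (V (Suc n)))" for n
      using Q[of n] by (simp add: snd_V V_def[of n])
  qed
qed

lemma speed_one_wave_exists:
  assumes bist: "bistable_reaction a K f"
    and "a < p" and "p \<le> K" and "p \<le> \<delta>" and "2 * p \<le> f p"
  shows "\<exists>w. wave_profile K w \<and> (\<forall>n. ca_update \<delta> f w n = w (n + 1))"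
proof -
  obtain V :: "nat \<Rightarrow> nat" where V0: "V 0 = 0" and "mono V" and V_le: "\<And>n. V n \<le> K"
    and V_pos: "\<And>n. a < V (Suc n)"
    and V1: "int (V 1) = flux \<delta> (f (V 1)) (f 0)"
    and V_rec: "\<And>n. int (V (Suc (Suc n))) = int (f (V (Suc n)))
       - flux \<delta> (f (V (Suc n))) (f (V n)) + flux \<delta> (f (V (Suc (Suc n)))) (f (V (Suc n)))"
    using monotone_front_exists[OF assms] by blast
  have f0: "f 0 = 0" and "0 < K"
    using bist by (auto simp: bistable_reaction_def)

  obtain m where m: "\<And>n. V n \<le> V m"
    using ex_has_greatest_nat[of "\<lambda>_. True" 0 V "Suc K"] V_le by (auto simp: less_Suc_eq_le)
  have const: "V n = V m" if "m \<le> n" for n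
    using m[of n] monoD[OF \<open>mono V\<close> that] by simp
  have "f (V m) = V m"
    using V_rec[of m] const[of "Suc m"] const[of "Suc (Suc m)"] by simp
  moreover have "a < V m"
    using m[of "Suc 0"] V_pos[of 0] by simp
  ultimately have "V m = K"
    using bistable_reaction_fixed_above[OF bist] V_le by blast

  define N where "N = (LEAST n. V n = K)"
  have VN: "V N = K"
    unfolding N_def using \<open>V m = K\<close> by (rule LeastI)
  have "N \<noteq> 0"
    using VN V0 \<open>0 < K\<close> by (metis less_irrefl)
  then have "V (N - 1) \<noteq> K"
    using not_less_Least[of "N - 1" "\<lambda>n. V n = K"] by (simp add: N_def)
  then have VN1: "V (N - 1) < K"
    using V_le by (simp add: order.not_eq_order_implies_strict)

  define w where "w n = V (nat n)" for n :: int
  have "wave_profile K w"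
    unfolding wave_profile_def
  proof (intro exI[of _ "int N"] conjI)
    show "1 \<le> int N"
      using \<open>N \<noteq> 0\<close> by simp
    show "\<forall>n\<le>0. w n = 0"
      by (simp add: w_def V0)
    show "\<forall>n\<ge>int N. w n = K"
      using VN V_le monoD[OF \<open>mono V\<close>] by (metis w_def le_antisym nat_int nat_mono)
    show "0 < w 1"
      using V_pos[of 0] by (simp add: w_def)
    show "\<forall>n. 1 \<le> n \<and> n < int N - 1 \<longrightarrow> w n \<le> w (n + 1)"
      using monoD[OF \<open>mono V\<close>] by (simp add: w_def nat_mono)
    have "nat (int N - 1) = N - 1"
      by linarith
    then show "w (int N - 1) < K"
      using VN1 by (simp add: w_def)
  qed
  moreover have "ca_update \<delta> f w n = w (n + 1)" for n
  proof -
    consider "n < 0" | "n = 0" | k where "n = 1 + int k"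
      by (metis int_one_le_iff_zero_less linorder_neqE zle_iff_zadd)
    then have "int (ca_update \<delta> f w n) = int (w (n + 1))"
    proof cases
      case 1
      then show ?thesis
        by (simp add: int_ca_update w_def V0 f0)
    next
      case 2
      then show ?thesis
        using V1 by (simp add: int_ca_update w_def V0 f0)
    next
      case 3
      then have "w (n - 1) = V k" "w n = V (Suc k)" "w (n + 1) = V (Suc (Suc k))"
        by (auto simp: w_def nat_add_distrib)
      then show ?thesis
        using V_rec[of k] flux_antisym[of \<delta> "f (V k)" "f (V (Suc k))"]
        by (simp add: int_ca_update)
    qed
    then show ?thesis by simp
  qed
  ultimately show ?thesis by blast
qed

section \<open>Characterisation of waves of speed one\<close>

lemma speed_one_wave_first_site:
  assumes "wave_profile K w" and "ca_update \<delta> f w 0 = w 1" and "f 0 = 0"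
  shows "0 < w 1" and "w 1 \<le> \<delta>" and "2 * w 1 \<le> f (w 1)"
proof -
  have w: "w 0 = 0" "w (-1) = 0" "0 < w 1"
    using assms(1) by (auto simp: wave_profile_def)
  then have "int (w 1) = flux \<delta> (f (w 1)) 0"
    using int_ca_update[of \<delta> f w 0] assms by simp
  then show "w 1 \<le> \<delta>" "2 * w 1 \<le> f (w 1)"
    using flux_le_bound[of \<delta> "f (w 1)" 0] two_flux_le_diff[of 0 "f (w 1)" \<delta>] by auto
  show "0 < w 1" by (rule w)
qed

theorem theorem3p6:
  fixes \<delta> a K :: nat and f :: "nat \<Rightarrow> nat"
  assumes "1 \<le> \<delta>"
    and "2 \<le> a" and "a + 2 \<le> K"
    and "bistable_reaction a K f"
  shows "(\<exists>w. wave_profile K w \<and> (\<forall>n. ca_update \<delta> f w n = w (n + 1))) \<longleftrightarrow>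
         (real a < real K / 2 \<and>
          (\<exists>p::nat. a < p \<and> real p \<le> real K / 2 \<and> p \<le> \<delta> \<and> 2 * p \<le> f p))"
    (is "?wave \<longleftrightarrow> ?cond")
proof
  assume ?wave
  then obtain w where w: "wave_profile K w" "\<forall>n. ca_update \<delta> f w n = w (n + 1)"
    by blast
  have "ca_update \<delta> f w 0 = w 1"
    using w(2) by (metis add_0)
  moreover have "f 0 = 0"
    using assms(4) by (simp add: bistable_reaction_def)
  ultimately have p: "0 < w 1" "w 1 \<le> \<delta>" "2 * w 1 \<le> f (w 1)"
    using speed_one_wave_first_site[OF w(1)] by blast+
  then have "a < w 1 \<and> w 1 < K \<and> f (w 1) \<le> K"
    by (intro bistable_reaction_growing[OF assms(4)]) simp
  with p have "a < w 1" "2 * w 1 \<le> K"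
    by linarith+
  then have "real a < real K / 2" "real (w 1) \<le> real K / 2"
    by linarith+
  with p \<open>a < w 1\<close> show ?cond by blast
next
  assume ?cond
  then obtain p where "a < p" "real p \<le> real K / 2" "p \<le> \<delta>" "2 * p \<le> f p"
    by blast
  then show ?wave
    by (intro speed_one_wave_exists[OF assms(4), of p]) auto
qed

end
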